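(* Let $R$ be a quasiorder on a non-empty set $U$. In the lattice $\mathcal{RS}$, for each $X\subseteq U$, the pseudocomplement of $\mathcal{A}(X)$ is $$\mathcal{A}(X)^*=\mathcal{A}(X^{\blacktriangle\vartriangle c}).$$
   Context: A quasiorder is a reflexive and transitive binary relation. For $x\in U$, $R(x)=\{y\in U\mid x\,R\,y\}$ and $R^{-1}(x)=\{y\in U\mid y\,R\,x\}$. For $X\subseteq U$, $X^{\blacktriangledown}=\{x\in U\mid R(x)\subseteq X\}$, $X^{\blacktriangle}=\{x\in U\mid R(x)\cap X\neq\emptyset\}$, $X^{\vartriangle}=\{x\in U\mid R^{-1}(x)\cap X\neq\emptyset\}$, and $X^c=U\setminus X$. Stacked superscripts are applied from left to right, so $X^{\blacktriangle\vartriangle c}=((X^{\blacktriangle})^{\vartriangle})^c$. The rough set of $X$ is $\mathcal{A}(X)=(X^{\blacktriangledown},X^{\blacktriangle})$, $RS=\{\mathcal{A}(X)\mid X\subseteq U\}$, and $\mathcal{RS}=(RS,\leq)$ with $\leq$ the coordinatewise inclusion order on pairs of sets; for a quasiorder $R$ on a non-empty set this is a complete lattice with coordinatewise unions and intersections as joins and meets and with least element $(\emptyset,\emptyset)$. In a lattice with least element $0$, the pseudocomplement $x^*$ of $x$ is the (unique if it exists) element with $x\wedge x^*=0$ such that, for all $a$, $x\wedge a=0$ implies $a\leq x^*$. *)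

theory Defs
  imports "HOL-Algebra.Complete_Lattice"
begin

text \<open>
  A quasiorder \<open>R\<close> on the set \<open>U\<close> is rendered as \<open>preorder_on U R\<close>; then \<open>R `` {x}\<close> is
  \<open>R(x)\<close> and \<open>R\<inverse> `` {x}\<close> is \<open>R\<inverse>(x)\<close>.
\<close>

definition lower_approx :: "'a set \<Rightarrow> 'a rel \<Rightarrow> 'a set \<Rightarrow> 'a set"
  where "lower_approx U R X = {x \<in> U. R `` {x} \<subseteq> X}"

definition upper_approx :: "'a set \<Rightarrow> 'a rel \<Rightarrow> 'a set \<Rightarrow> 'a set"
  where "upper_approx U R X = {x \<in> U. R `` {x} \<inter> X \<noteq> {}}"

definition upper_approx_inv :: "'a set \<Rightarrow> 'a rel \<Rightarrow> 'a set \<Rightarrow> 'a set"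
  where "upper_approx_inv U R X = {x \<in> U. R\<inverse> `` {x} \<inter> X \<noteq> {}}"

definition rough_set :: "'a set \<Rightarrow> 'a rel \<Rightarrow> 'a set \<Rightarrow> 'a set \<times> 'a set"
  where "rough_set U R X = (lower_approx U R X, upper_approx U R X)"

definition RS :: "'a set \<Rightarrow> 'a rel \<Rightarrow> ('a set \<times> 'a set) gorder"
  where "RS U R =
    \<lparr> carrier = {rough_set U R X | X. X \<subseteq> U},
      eq = (=),
      le = (\<lambda>p q. fst p \<subseteq> fst q \<and> snd p \<subseteq> snd q) \<rparr>"

text \<open>
  In HOL-Algebra, \<open>\<sqinter>\<close> and \<open>\<bottom>\<close> are chosen greatest lower bounds and least elements, so the
  following is meaningful for lattices with a least element. That \<open>RS U R\<close> is one is
  \<open>RS_complete_lattice\<close> below.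
\<close>

definition is_pseudocomplement :: "('a, 'b) gorder_scheme \<Rightarrow> 'a \<Rightarrow> 'a \<Rightarrow> bool"
  where "is_pseudocomplement L x p \<longleftrightarrow>
    p \<in> carrier L \<and> x \<sqinter>\<^bsub>L\<^esub> p = \<bottom>\<^bsub>L\<^esub> \<and>
    (\<forall>a \<in> carrier L. x \<sqinter>\<^bsub>L\<^esub> a = \<bottom>\<^bsub>L\<^esub> \<longrightarrow> a \<sqsubseteq>\<^bsub>L\<^esub> p)"

lemma (in partial_order) pseudocomplement_unique:
  assumes "is_pseudocomplement L x p" and "is_pseudocomplement L x q"
  shows "p = q"
  using assms unfolding is_pseudocomplement_def by (meson le_antisym)


subsection \<open>Rough sets of a quasiorder form a complete lattice\<close>

lemma cofinal_splitting:
  assumes r: "refl_on E R" and t: "trans R"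
    and up: "R `` E \<subseteq> E"
    and ns: "\<forall>x\<in>E. R `` {x} \<noteq> {x}"
  shows "\<exists>W\<subseteq>E. \<forall>x\<in>E. R `` {x} \<inter> W \<noteq> {} \<and> R `` {x} - W \<noteq> {}"
proof -
  define F :: "('a \<times> bool) set set" where "F = {M. fst ` M \<subseteq> E \<and>
     (\<forall>p. \<not> ((p, True) \<in> M \<and> (p, False) \<in> M)) \<and>
     (\<forall>p b. (p, b) \<in> M \<longrightarrow> (\<exists>q. (q, \<not> b) \<in> M \<and> (p, q) \<in> R))}"
  have "\<exists>M\<in>F. \<forall>X\<in>F. M \<subseteq> X \<longrightarrow> X = M"
  proof (rule subset_Zorn')
    fix C assume "subset.chain F C"
    then have C: "C \<subseteq> F" "\<And>A B. A \<in> C \<Longrightarrow> B \<in> C \<Longrightarrow> A \<subseteq> B \<or> B \<subseteq> A"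
      unfolding subset_chain_def by auto
    have 1: "fst ` \<Union>C \<subseteq> E" using C(1) unfolding F_def by blast
    have 2: "\<not> ((p, True) \<in> \<Union>C \<and> (p, False) \<in> \<Union>C)" for p
    proof
      assume "(p, True) \<in> \<Union>C \<and> (p, False) \<in> \<Union>C"
      then obtain A B where AB: "A \<in> C" "B \<in> C" "(p, True) \<in> A" "(p, False) \<in> B" by blast
      then consider "A \<subseteq> B" | "B \<subseteq> A" using C(2) by blast
      then show False using AB C(1) unfolding F_def by cases blast+
    qed
    have 3: "\<exists>q. (q, \<not> b) \<in> \<Union>C \<and> (p, q) \<in> R" if pb: "(p, b) \<in> \<Union>C" for p b
    proof -
      obtain A where A: "A \<in> C" "(p, b) \<in> A" using pb by blast
      then have "\<exists>q. (q, \<not> b) \<in> A \<and> (p, q) \<in> R" using C(1) unfolding F_def by blast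
      then show ?thesis using A by blast
    qed
    show "\<Union>C \<in> F" using 1 2 3 unfolding F_def by blast
  qed
  then obtain M where M: "M \<in> F" and max: "\<And>X. X \<in> F \<Longrightarrow> M \<subseteq> X \<Longrightarrow> X = M" by blast
  have fst_M: "fst ` M \<subseteq> E"
    and M_fun: "\<And>p. (p, True) \<in> M \<Longrightarrow> (p, False) \<in> M \<Longrightarrow> False"
    and M_cof: "\<And>p b. (p, b) \<in> M \<Longrightarrow> \<exists>q. (q, \<not> b) \<in> M \<and> (p, q) \<in> R"
    using M unfolding F_def by blast+
  have extend: False
    if N: "N \<in> F" "N \<noteq> {}" and x: "x \<in> E" "R `` {x} \<inter> fst ` M = {}" "fst ` N \<subseteq> R `` {x}" for N x
  proof -
    have disj: "fst ` N \<inter> fst ` M = {}" using x by blast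
    have 1: "fst ` (M \<union> N) \<subseteq> E" using N M unfolding F_def by blast
    have 2: "\<not> ((p, True) \<in> M \<union> N \<and> (p, False) \<in> M \<union> N)" for p
    proof
      assume *: "(p, True) \<in> M \<union> N \<and> (p, False) \<in> M \<union> N"
      have "\<not> ((p, True) \<in> N \<and> (p, False) \<in> N)" using N unfolding F_def by blast
      moreover have "\<not> ((p, True) \<in> M \<and> (p, False) \<in> M)" using M_fun by blast
      ultimately show False using * disj by force
    qed
    have 3: "\<exists>q. (q, \<not> b) \<in> M \<union> N \<and> (p, q) \<in> R" if "(p, b) \<in> M \<union> N" for p b
    proof -
      have "(p, b) \<in> N \<Longrightarrow> \<exists>q. (q, \<not> b) \<in> N \<and> (p, q) \<in> R" using N unfolding F_def by blast
      then show ?thesis using that M_cof by blast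
    qed
    have "M \<union> N \<in> F" using 1 2 3 unfolding F_def by blast
    then have "N \<subseteq> M" using max by blast
    then show False using disj N(2) by blast
  qed
  have meets: "R `` {x} \<inter> fst ` M \<noteq> {}" if x: "x \<in> E" for x
  proof
    assume none: "R `` {x} \<inter> fst ` M = {}"
    show False
    proof (cases "\<exists>y z. (x, y) \<in> R \<and> y \<noteq> z \<and> (y, z) \<in> R \<and> (z, y) \<in> R")
      case True
      then obtain y z where yz: "(x, y) \<in> R" "y \<noteq> z" "(y, z) \<in> R" "(z, y) \<in> R" by blast
      have xz: "(x, z) \<in> R" using yz t by (meson transD)
      have E: "y \<in> E" "z \<in> E" using x up yz xz by blast+
      have "{(y, True), (z, False)} \<in> F" using yz E unfolding F_def by auto
      then show False
        by (rule extend[OF _ _ x none]) (use yz xz in auto)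
    next
      case False
      have step: "\<exists>z. (y, z) \<in> R \<and> z \<noteq> y" if "(x, y) \<in> R" for y
      proof -
        have "y \<in> E" using that x up by blast
        then have "R `` {y} \<noteq> {y}" "(y, y) \<in> R" using ns r by (auto simp: refl_on_def)
        then show ?thesis by blast
      qed
      define g where "g y = (SOME z. (y, z) \<in> R \<and> z \<noteq> y)" for y
      have g: "(y, g y) \<in> R" "g y \<noteq> y" if "(x, y) \<in> R" for y
        using someI_ex[OF step[OF that]] unfolding g_def by auto
      define f where "f n = (g ^^ n) x" for n :: nat
      have f0: "(x, f n) \<in> R" for n
      proof (induction n)
        case 0
        then show ?case using x r by (simp add: f_def refl_on_def)
      next
        case (Suc n)
        have "f (Suc n) = g (f n)" by (simp add: f_def)
        then show ?case using Suc g(1)[OF Suc] t by (metis transD)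
      qed
      have f1: "(f n, f (Suc n)) \<in> R" "f (Suc n) \<noteq> f n" for n
        using g[OF f0[of n]] by (simp_all add: f_def)
      have fE: "f n \<in> E" for n using f0 x up by blast
      have le: "(f m, f n) \<in> R" if "m \<le> n" for m n
        using that
      proof (induction rule: dec_induct)
        case base
        then show ?case using fE r by (simp add: refl_on_def)
      next
        case (step k)
        then show ?case using f1(1)[of k] t by (meson transD)
      qed
      have lt: "f m \<noteq> f n" if "m < n" for m n
      proof
        assume eq: "f m = f n"
        have "(f (Suc m), f m) \<in> R" using le[of "Suc m" n] that eq by simp
        then show False using False f1[of m] f0[of m] by metis
      qed
      have inj: "f m = f n \<Longrightarrow> m = n" for m n using lt by (metis linorder_neqE_nat)
      define N where "N = range (\<lambda>n. (f n, even n))"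
      have 1: "fst ` N \<subseteq> E" using fE unfolding N_def by auto
      have 2: "\<not> ((p, True) \<in> N \<and> (p, False) \<in> N)" for p
        using inj unfolding N_def by auto
      have 3: "\<exists>q. (q, \<not> b) \<in> N \<and> (p, q) \<in> R" if pb: "(p, b) \<in> N" for p b
      proof -
        obtain n where n: "p = f n" "b = even n" using pb unfolding N_def by blast
        have "(f (Suc n), even (Suc n)) \<in> N" unfolding N_def by blast
        then show ?thesis using n f1(1)[of n] by auto
      qed
      have "N \<in> F" using 1 2 3 unfolding F_def by blast
      then show False
        by (rule extend[OF _ _ x none]) (use f0 in \<open>auto simp: N_def\<close>)
    qed
  qed
  have both: "\<exists>q. (q, b) \<in> M \<and> (x, q) \<in> R" if x: "x \<in> E" for x b
  proof -
    obtain p c where p: "(x, p) \<in> R" "(p, c) \<in> M" using meets[OF x] by force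
    obtain q where q: "(q, \<not> c) \<in> M" "(p, q) \<in> R" using M_cof[OF p(2)] by blast
    have "(x, q) \<in> R" using p q t by (meson transD)
    then show ?thesis using p q by (cases "b = c") auto
  qed
  show ?thesis
  proof (intro exI[of _ "{p. (p, True) \<in> M}"] conjI ballI)
    show "{p. (p, True) \<in> M} \<subseteq> E" using fst_M by force
    show "R `` {x} \<inter> {p. (p, True) \<in> M} \<noteq> {}" if "x \<in> E" for x
      using both[OF that, of True] by blast
    show "R `` {x} - {p. (p, True) \<in> M} \<noteq> {}" if "x \<in> E" for x
      using both[OF that, of False] M_fun by blast
  qed
qed

text \<open>
  Pairs of this form are exactly the rough sets, which makes closure under coordinatewise
  unions and intersections evident.
\<close>

definition rough_pair :: "'a set \<Rightarrow> 'a rel \<Rightarrow> 'a set \<Rightarrow> 'a set \<Rightarrow> bool"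
  where "rough_pair U R A B \<longleftrightarrow> A \<subseteq> U \<and> B \<subseteq> U \<and> R `` A \<subseteq> A \<and> R\<inverse> `` B \<subseteq> B \<and> R\<inverse> `` A \<subseteq> B \<and>
    (\<forall>x \<in> {x \<in> U. R `` {x} = {x}}. x \<in> A \<longleftrightarrow> x \<in> B)"

lemma rough_pair_iff:
  assumes "preorder_on U R"
  shows "(A, B) \<in> carrier (RS U R) \<longleftrightarrow> rough_pair U R A B"
proof
  have r: "\<And>x. x \<in> U \<Longrightarrow> (x, x) \<in> R" and s: "\<And>x y. (x, y) \<in> R \<Longrightarrow> x \<in> U \<and> y \<in> U"
    and t: "\<And>x y z. (x, y) \<in> R \<Longrightarrow> (y, z) \<in> R \<Longrightarrow> (x, z) \<in> R"
    using assms unfolding preorder_on_def refl_on_def by (auto dest: transD)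
  {
    assume "(A, B) \<in> carrier (RS U R)"
    then obtain X where X: "X \<subseteq> U" "A = lower_approx U R X" "B = upper_approx U R X"
      by (auto simp: RS_def rough_set_def)
    have "R `` A \<subseteq> A" "R\<inverse> `` B \<subseteq> B" "R\<inverse> `` A \<subseteq> B"
      using X(2,3) r s t unfolding lower_approx_def upper_approx_def by blast+
    then show "rough_pair U R A B"
      using X(2,3) unfolding rough_pair_def lower_approx_def upper_approx_def by auto
  }
  {
    assume p: "rough_pair U R A B"
    then have A: "A \<subseteq> U" "\<And>x y. x \<in> A \<Longrightarrow> (x, y) \<in> R \<Longrightarrow> y \<in> A"
      and B: "B \<subseteq> U" "\<And>x y. y \<in> B \<Longrightarrow> (x, y) \<in> R \<Longrightarrow> x \<in> B"
      and AB: "\<And>x y. y \<in> A \<Longrightarrow> (x, y) \<in> R \<Longrightarrow> x \<in> B"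
      and S: "\<And>x. x \<in> U \<Longrightarrow> R `` {x} = {x} \<Longrightarrow> x \<in> A \<longleftrightarrow> x \<in> B"
      unfolding rough_pair_def by blast+
    have AsubB: "A \<subseteq> B" using A(1) AB r by blast
    define E where "E = {x \<in> B - A. R `` {x} \<subseteq> B - A}"
    have EU: "E \<subseteq> U" using B(1) unfolding E_def by blast
    have E1: "refl_on E R" using EU r by (auto simp: refl_on_def)
    have E2: "trans R" using assms by (simp add: preorder_on_def)
    have E3: "R `` E \<subseteq> E" using t unfolding E_def by blast
    have E4: "\<forall>x\<in>E. R `` {x} \<noteq> {x}" using S EU unfolding E_def by blast
    obtain W where W: "W \<subseteq> E"
      "\<And>x. x \<in> E \<Longrightarrow> R `` {x} \<inter> W \<noteq> {}" "\<And>x. x \<in> E \<Longrightarrow> R `` {x} - W \<noteq> {}"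
      using cofinal_splitting[OF E1 E2 E3 E4] by blast
    define Z where "Z = A \<union> W \<union> {x \<in> B - A - E. R `` {x} \<inter> A = {} \<and> R `` {x} \<inter> E = {}}"
    have ZB: "Z \<subseteq> B" using AsubB W(1) unfolding Z_def E_def by blast
    have out: "\<not> R `` {x} \<subseteq> Z" if x: "x \<in> U" "x \<notin> A" for x
    proof -
      consider "x \<notin> B" | y where "(x, y) \<in> R" "y \<in> E"
        | "x \<in> B" "R `` {x} \<inter> E = {}" "R `` {x} \<inter> A \<noteq> {}"
        | "x \<in> B" "R `` {x} \<inter> E = {}" "R `` {x} \<inter> A = {}" by blast
      then show ?thesis
      proof cases
        case 1
        then show ?thesis using x r ZB by blast
      next
        case 2
        obtain z where z: "(y, z) \<in> R" "z \<notin> W" using W(3)[OF 2(2)] by blast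
        have "z \<in> E" using z 2 t unfolding E_def by blast
        then have "z \<notin> Z" using z unfolding Z_def E_def by blast
        then show ?thesis using 2 z t by blast
      next
        case 3
        have "x \<notin> E" using 3 x r by blast
        then have "x \<notin> Z" using 3 x W(1) unfolding Z_def by blast
        then show ?thesis using x r by blast
      next
        case 4
        have "x \<notin> E" using 4 x r by blast
        then obtain y where "(x, y) \<in> R" "y \<notin> B - A" using 4 x unfolding E_def by blast
        then have "(x, y) \<in> R" "y \<notin> B" using 4 by blast+
        then show ?thesis using ZB by blast
      qed
    qed
    have hit: "R `` {x} \<inter> Z \<noteq> {}" if x: "x \<in> B" for x
    proof -
      have xx: "(x, x) \<in> R" using x B(1) r by blast
      consider "R `` {x} \<inter> A \<noteq> {}" | y where "(x, y) \<in> R" "y \<in> E"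
        | "R `` {x} \<inter> E = {}" "R `` {x} \<inter> A = {}" by blast
      then show ?thesis
      proof cases
        case 1
        then show ?thesis unfolding Z_def by blast
      next
        case 2
        then obtain z where "(y, z) \<in> R" "z \<in> W" using W(2)[OF 2(2)] by blast
        then show ?thesis using 2 t unfolding Z_def by blast
      next
        case 3
        then have "x \<in> Z" using x xx unfolding Z_def by blast
        then show ?thesis using xx by blast
      qed
    qed
    have "A = lower_approx U R Z"
    proof
      show "A \<subseteq> lower_approx U R Z" using A unfolding lower_approx_def Z_def by blast
      show "lower_approx U R Z \<subseteq> A" using out unfolding lower_approx_def by blast
    qed
    moreover have "B = upper_approx U R Z"
    proof
      show "B \<subseteq> upper_approx U R Z" using hit B(1) unfolding upper_approx_def by blast
      show "upper_approx U R Z \<subseteq> B" using ZB B(2) unfolding upper_approx_def by blast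
    qed
    moreover have "Z \<subseteq> U" using ZB B(1) by blast
    ultimately show "(A, B) \<in> carrier (RS U R)"
      by (auto simp: RS_def rough_set_def)
  }
qed

lemma rough_pair_Union:
  assumes "\<And>p. p \<in> \<A> \<Longrightarrow> rough_pair U R (fst p) (snd p)"
  shows "rough_pair U R (\<Union>(fst ` \<A>)) (\<Union>(snd ` \<A>))"
proof -
  define S where "S = {x \<in> U. R `` {x} = {x}}"
  have *: "fst p \<subseteq> U" "snd p \<subseteq> U" "R `` fst p \<subseteq> fst p" "R\<inverse> `` snd p \<subseteq> snd p"
    "R\<inverse> `` fst p \<subseteq> snd p" "\<forall>x\<in>S. x \<in> fst p \<longleftrightarrow> x \<in> snd p" if "p \<in> \<A>" for p
    using assms[OF that] unfolding rough_pair_def S_def by auto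
  show ?thesis
    unfolding rough_pair_def S_def[symmetric]
  proof (intro conjI)
    show "\<Union>(fst ` \<A>) \<subseteq> U" using *(1) by blast
    show "\<Union>(snd ` \<A>) \<subseteq> U" using *(2) by blast
    show "R `` \<Union>(fst ` \<A>) \<subseteq> \<Union>(fst ` \<A>)" using *(3) by blast
    show "R\<inverse> `` \<Union>(snd ` \<A>) \<subseteq> \<Union>(snd ` \<A>)" using *(4) by blast
    show "R\<inverse> `` \<Union>(fst ` \<A>) \<subseteq> \<Union>(snd ` \<A>)" using *(5) by blast
    show "\<forall>x\<in>S. x \<in> \<Union>(fst ` \<A>) \<longleftrightarrow> x \<in> \<Union>(snd ` \<A>)" using *(6) by auto
  qed
qed

lemma rough_pair_Inter:
  assumes "preorder_on U R" and "\<And>p. p \<in> \<A> \<Longrightarrow> rough_pair U R (fst p) (snd p)"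
  shows "rough_pair U R (U \<inter> \<Inter>(fst ` \<A>)) (U \<inter> \<Inter>(snd ` \<A>))"
proof -
  define S where "S = {x \<in> U. R `` {x} = {x}}"
  have U: "R \<subseteq> U \<times> U" using assms(1) unfolding preorder_on_def by auto
  have *: "R `` fst p \<subseteq> fst p" "R\<inverse> `` snd p \<subseteq> snd p"
    "R\<inverse> `` fst p \<subseteq> snd p" "\<forall>x\<in>S. x \<in> fst p \<longleftrightarrow> x \<in> snd p" if "p \<in> \<A>" for p
    using assms(2)[OF that] unfolding rough_pair_def S_def by auto
  show ?thesis
    unfolding rough_pair_def S_def[symmetric]
  proof (intro conjI)
    show "R `` (U \<inter> \<Inter>(fst ` \<A>)) \<subseteq> U \<inter> \<Inter>(fst ` \<A>)" using *(1) U by blast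
    show "R\<inverse> `` (U \<inter> \<Inter>(snd ` \<A>)) \<subseteq> U \<inter> \<Inter>(snd ` \<A>)" using *(2) U by blast
    show "R\<inverse> `` (U \<inter> \<Inter>(fst ` \<A>)) \<subseteq> U \<inter> \<Inter>(snd ` \<A>)" using *(3) U by blast
    show "\<forall>x\<in>S. x \<in> U \<inter> \<Inter>(fst ` \<A>) \<longleftrightarrow> x \<in> U \<inter> \<Inter>(snd ` \<A>)" using *(4) by auto
  qed auto
qed

lemma RS_le: "p \<sqsubseteq>\<^bsub>RS U R\<^esub> q \<longleftrightarrow> fst p \<subseteq> fst q \<and> snd p \<subseteq> snd q"
  by (simp add: RS_def)

lemma RS_eq: "(.=\<^bsub>RS U R\<^esub>) = (=)"
  by (simp add: RS_def)

lemma RS_sup: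
  assumes "preorder_on U R" and "\<A> \<subseteq> carrier (RS U R)"
  shows "is_lub (RS U R) (\<Union>(fst ` \<A>), \<Union>(snd ` \<A>)) \<A>"
proof -
  have "rough_pair U R (fst p) (snd p)" if "p \<in> \<A>" for p
    using that assms rough_pair_iff[OF assms(1), of "fst p" "snd p"] by auto
  then have "rough_pair U R (\<Union>(fst ` \<A>)) (\<Union>(snd ` \<A>))"
    by (rule rough_pair_Union)
  then have "(\<Union>(fst ` \<A>), \<Union>(snd ` \<A>)) \<in> carrier (RS U R)"
    by (simp add: rough_pair_iff[OF assms(1)])
  moreover have "p \<sqsubseteq>\<^bsub>RS U R\<^esub> (\<Union>(fst ` \<A>), \<Union>(snd ` \<A>))" if "p \<in> \<A>" for p
    using that by (auto simp: RS_le)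
  moreover have "(\<Union>(fst ` \<A>), \<Union>(snd ` \<A>)) \<sqsubseteq>\<^bsub>RS U R\<^esub> q" if "q \<in> Upper (RS U R) \<A>" for q
  proof -
    have "fst p \<subseteq> fst q \<and> snd p \<subseteq> snd q" if "p \<in> \<A>" for p
      using \<open>q \<in> Upper (RS U R) \<A>\<close> that assms(2) unfolding Upper_def RS_le by blast
    then show ?thesis by (simp add: RS_le UN_subset_iff)
  qed
  ultimately show ?thesis by (auto simp: least_def Upper_def)
qed

lemma RS_inf:
  assumes "preorder_on U R" and "\<A> \<subseteq> carrier (RS U R)"
  shows "is_glb (RS U R) (U \<inter> \<Inter>(fst ` \<A>), U \<inter> \<Inter>(snd ` \<A>)) \<A>"
proof -
  have all: "rough_pair U R (fst p) (snd p)" if "p \<in> carrier (RS U R)" for p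
    using that rough_pair_iff[OF assms(1), of "fst p" "snd p"] by auto
  have "rough_pair U R (U \<inter> \<Inter>(fst ` \<A>)) (U \<inter> \<Inter>(snd ` \<A>))"
    by (rule rough_pair_Inter[OF assms(1) all]) (use assms(2) in blast)
  then have "(U \<inter> \<Inter>(fst ` \<A>), U \<inter> \<Inter>(snd ` \<A>)) \<in> carrier (RS U R)"
    by (simp add: rough_pair_iff[OF assms(1)])
  moreover have "(U \<inter> \<Inter>(fst ` \<A>), U \<inter> \<Inter>(snd ` \<A>)) \<sqsubseteq>\<^bsub>RS U R\<^esub> p" if "p \<in> \<A>" for p
    using that by (auto simp: RS_le)
  moreover have "q \<sqsubseteq>\<^bsub>RS U R\<^esub> (U \<inter> \<Inter>(fst ` \<A>), U \<inter> \<Inter>(snd ` \<A>))" if "q \<in> Lower (RS U R) \<A>" for q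
  proof -
    have "fst q \<subseteq> fst p \<and> snd q \<subseteq> snd p" if "p \<in> \<A>" for p
      using \<open>q \<in> Lower (RS U R) \<A>\<close> that assms(2) unfolding Lower_def RS_le by blast
    moreover have "fst q \<subseteq> U" "snd q \<subseteq> U"
      using that all[of q] unfolding Lower_def rough_pair_def by auto
    ultimately show ?thesis by (simp add: RS_le le_INF_iff)
  qed
  ultimately show ?thesis by (auto simp: greatest_def Lower_def)
qed

theorem RS_complete_lattice:
  assumes "preorder_on U R"
  shows "complete_lattice (RS U R)"
proof -
  interpret partial_order "RS U R"
    by unfold_locales (auto simp: RS_eq RS_le)
  show ?thesis
    by unfold_locales (use RS_sup[OF assms] RS_inf[OF assms] in blast)+
qed

lemma RS_meet:
  assumes "preorder_on U R" and "p \<in> carrier (RS U R)" and "q \<in> carrier (RS U R)"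
  shows "p \<sqinter>\<^bsub>RS U R\<^esub> q = (fst p \<inter> fst q, snd p \<inter> snd q)"
proof -
  interpret complete_lattice "RS U R" by (rule RS_complete_lattice[OF assms(1)])
  have "fst p \<subseteq> U" "snd p \<subseteq> U"
    using rough_pair_iff[OF assms(1), of "fst p" "snd p"] assms(2) unfolding rough_pair_def by auto
  then have "is_glb (RS U R) (fst p \<inter> fst q, snd p \<inter> snd q) {p, q}"
    using RS_inf[OF assms(1), of "{p, q}"] assms(2,3) by (simp add: Int_absorb1 inf.absorb2 Int_assoc[symmetric])
  then show ?thesis
    unfolding meet_def inf_def by (metis (lifting) greatest_unique someI)
qed

lemma RS_bottom:
  assumes "preorder_on U R"
  shows "\<bottom>\<^bsub>RS U R\<^esub> = ({}, {})"
proof -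
  interpret complete_lattice "RS U R" by (rule RS_complete_lattice[OF assms(1)])
  have "({}, {}) \<in> carrier (RS U R)"
    by (simp add: rough_pair_iff[OF assms] rough_pair_def)
  then have "\<bottom>\<^bsub>RS U R\<^esub> \<sqsubseteq>\<^bsub>RS U R\<^esub> ({}, {})" by simp
  then show ?thesis by (simp add: RS_le prod_eq_iff)
qed

end

theory Submission
  imports Defs
begin

text \<open>
  For a quasiorder, upper approximations are down-sets. Two rough sets have meet \<open>\<bottom>\<close> exactly
  when their upper parts \<open>B\<close> and \<open>B'\<close> are disjoint, since the lower part of a rough set lies
  inside its upper part (\<open>RS_meet_bottom_iff\<close>). A down-set \<open>B'\<close> misses \<open>B\<close> exactly when it
  misses the up-set generated by \<open>B\<close>: from a point of \<open>B'\<close> above \<open>B\<close> one can descend, without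
  leaving \<open>B'\<close>, into \<open>B\<close> (\<open>down_closed_disjoint_upper_approx_inv\<close>). So the complement \<open>C\<close> of
  that up-set is the largest down-set disjoint from \<open>B\<close>. Being a down-set, \<open>C\<close> is its own upper
  approximation, so the rough set of \<open>C\<close> has the largest possible upper part. Its lower part is
  also the largest possible: everything above a point of the lower part of a rough set lies in
  the upper part, so if the upper part is inside \<open>C\<close>, then the lower part is inside the lower
  approximation of \<open>C\<close>.
\<close>

lemma upper_approx_down_closed:
  assumes "trans R" and "R \<subseteq> U \<times> U"
  shows "R\<inverse> `` upper_approx U R X \<subseteq> upper_approx U R X"
  using assms unfolding upper_approx_def by (blast dest: transD)

lemma upper_approx_of_down_closed:
  assumes "refl_on U R" and "C \<subseteq> U" and "R\<inverse> `` C \<subseteq> C"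
  shows "upper_approx U R C = C"
  using assms unfolding upper_approx_def refl_on_def by blast

lemma upper_approx_inv_up_closed:
  assumes "trans R" and "R \<subseteq> U \<times> U"
  shows "R `` upper_approx_inv U R B \<subseteq> upper_approx_inv U R B"
  using assms unfolding upper_approx_inv_def by (blast dest: transD)

lemma subset_upper_approx_inv:
  assumes "refl_on U R" and "B \<subseteq> U"
  shows "B \<subseteq> upper_approx_inv U R B"
  using assms unfolding upper_approx_inv_def refl_on_def by blast

text \<open>
  A common point of the up-set generated by \<open>B\<close> and of the down-set \<open>B'\<close> lies above some
  point of \<open>B\<close>, which is then in \<open>B'\<close> as well. This is the source of maximality.
\<close>

lemma down_closed_disjoint_upper_approx_inv:
  assumes "R\<inverse> `` B' \<subseteq> B'" and "B \<inter> B' = {}"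
  shows "upper_approx_inv U R B \<inter> B' = {}"
  using assms unfolding upper_approx_inv_def by blast

lemma rough_set_in_RS:
  assumes "X \<subseteq> U"
  shows "rough_set U R X \<in> carrier (RS U R)"
  using assms by (auto simp: RS_def)

text \<open>
  Reflexivity puts the lower part of a rough set inside its upper part, so disjoint upper parts
  force disjoint lower parts.
\<close>

lemma RS_meet_bottom_iff:
  assumes R: "preorder_on U R" and p: "p \<in> carrier (RS U R)" and q: "q \<in> carrier (RS U R)"
  shows "p \<sqinter>\<^bsub>RS U R\<^esub> q = \<bottom>\<^bsub>RS U R\<^esub> \<longleftrightarrow> snd p \<inter> snd q = {}"
proof -
  have "fst r \<subseteq> snd r" if "r \<in> carrier (RS U R)" for r
  proof -
    have "rough_pair U R (fst r) (snd r)"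
      using that rough_pair_iff[OF R, of "fst r" "snd r"] by simp
    moreover have "refl_on U R"
      using R by (simp add: preorder_on_def)
    ultimately show ?thesis
      unfolding rough_pair_def refl_on_def by blast
  qed
  then have "fst p \<inter> fst q \<subseteq> snd p \<inter> snd q"
    using p q by blast
  then show ?thesis
    by (auto simp: RS_meet[OF R p q] RS_bottom[OF R])
qed

theorem proposition4p2:
  fixes U :: "'a set" and R :: "'a rel" and X :: "'a set"
  assumes "U \<noteq> {}" and "preorder_on U R" and "X \<subseteq> U"
  shows "is_pseudocomplement (RS U R) (rough_set U R X)
           (rough_set U R (U - upper_approx_inv U R (upper_approx U R X)))"
proof -
  have refl: "refl_on U R" and trans: "trans R" and RU: "R \<subseteq> U \<times> U"
    using assms(2) by (auto simp: preorder_on_def)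
  define B where "B = upper_approx U R X"
  define C where "C = U - upper_approx_inv U R B"
  have BU: "B \<subseteq> U" and CU: "C \<subseteq> U"
    by (auto simp: B_def C_def upper_approx_def)
  have "R\<inverse> `` C \<subseteq> C"
    using upper_approx_inv_up_closed[OF trans RU, of B] RU unfolding C_def by blast
  then have upper_C: "upper_approx U R C = C"
    by (rule upper_approx_of_down_closed[OF refl CU])
  have X_RS: "rough_set U R X \<in> carrier (RS U R)"
    by (rule rough_set_in_RS[OF assms(3)])
  have C_RS: "rough_set U R C \<in> carrier (RS U R)"
    by (rule rough_set_in_RS[OF CU])
  have "B \<inter> C = {}"
    using subset_upper_approx_inv[OF refl BU] unfolding C_def by blast
  then have "rough_set U R X \<sqinter>\<^bsub>RS U R\<^esub> rough_set U R C = \<bottom>\<^bsub>RS U R\<^esub>"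
    unfolding RS_meet_bottom_iff[OF assms(2) X_RS C_RS] by (simp add: rough_set_def upper_C B_def)
  moreover have "a \<sqsubseteq>\<^bsub>RS U R\<^esub> rough_set U R C"
    if a: "a \<in> carrier (RS U R)"
      and meet: "rough_set U R X \<sqinter>\<^bsub>RS U R\<^esub> a = \<bottom>\<^bsub>RS U R\<^esub>" for a
  proof -
    obtain Y where Y: "a = rough_set U R Y"
      using a by (auto simp: RS_def)
    have "B \<inter> upper_approx U R Y = {}"
      using meet unfolding RS_meet_bottom_iff[OF assms(2) X_RS a] by (simp add: Y rough_set_def B_def)
    then have "upper_approx_inv U R B \<inter> upper_approx U R Y = {}"
      by (rule down_closed_disjoint_upper_approx_inv[OF upper_approx_down_closed[OF trans RU]])
    then have upper: "upper_approx U R Y \<subseteq> C"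
      by (auto simp: C_def upper_approx_def)
    have "lower_approx U R Y \<subseteq> lower_approx U R C"
    proof -
      \<comment> \<open>Each successor \<open>y\<close> of a point of the lower part is in \<open>Y\<close> and is its own successor.\<close>
      have "R `` {x} \<subseteq> upper_approx U R Y" if "x \<in> lower_approx U R Y" for x
        using that refl RU unfolding lower_approx_def upper_approx_def refl_on_def by blast
      then show ?thesis
        using upper unfolding lower_approx_def by blast
    qed
    with upper show ?thesis
      by (simp add: Y RS_le rough_set_def upper_C)
  qed
  ultimately show ?thesis
    using C_RS unfolding is_pseudocomplement_def C_def B_def by blast
qed

end
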